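(* The set of accumulation points in $\mathbb{R}$ of the set $\{P_{k,\ell}: k,\ell\in\mathbb{N},\ k,\ell\geq 1\}$ consists exactly of $\frac{1}{2}$, the real numbers $e^{-k}\sum_{\nu=0}^{k-1}\frac{k^\nu}{\nu!}$ for integers $k\geq 1$, and the real numbers $1-e^{-\ell}\sum_{\nu=0}^{\ell}\frac{\ell^\nu}{\nu!}$ for integers $\ell\geq 1$.
   Context: For integers $k,\ell\geq 1$ define \[ P_{k,\ell} = \frac{(k+\ell)!}{(k-1)!\,\ell!}\int_{k/(k+\ell)}^1 t^{k-1}(1-t)^\ell\,dt. \] A real number $a$ is an accumulation point of a set $S\subseteq\mathbb{R}$ if every neighbourhood of $a$ contains a point of $S$ different from $a$. *)

theory Defs
  imports "HOL-Analysis.Analysis"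
begin

text \<open>Only meant for \<open>k \<ge> 1\<close>; there the natural-number subtraction \<open>k - 1\<close> is not truncated.\<close>

definition P :: "nat \<Rightarrow> nat \<Rightarrow> real" where
  "P k l = fact (k + l) / (fact (k - 1) * fact l) *
     integral {real k / real (k + l)..1} (\<lambda>t. t ^ (k - 1) * (1 - t) ^ l)"

end

theory Submission
  imports Defs "HOL-Computational_Algebra.Primes"
begin

text \<open>By the incomplete beta integral, \<open>P k l\<close> is the probability that a binomial variable \<open>X\<close> with
  \<open>k + l\<close> trials and mean \<open>k\<close> is less than \<open>k\<close>. For fixed \<open>k\<close> or fixed \<open>l\<close> the Poisson limit theorem
  gives the limit along the row or column. The median of \<open>X\<close> is its mean, so
  \<open>P k l \<le> 1/2\<close> and \<open>P l k \<le> 1/2\<close>, while \<open>P k l + P l k + Pr (X = k) = 1\<close>; as the central mass tends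
  to 0, \<open>P k l\<close> tends to \<open>1/2\<close> when both parameters grow. Hence there are no other accumulation
  points. Each limit is an accumulation point because infinitely many values occur along the way: if
  \<open>p = k + l\<close> is prime, \<open>P k l\<close> in lowest terms has denominator \<open>p ^ p\<close>.\<close>

section \<open>Binomial masses with mean \<open>k\<close>\<close>

text \<open>The probability of \<open>j\<close> successes in \<open>k + l\<close> trials with
  success probability \<open>k / (k + l)\<close>. Collecting the denominators into the single power
  \<open>(k + l) ^ (k + l)\<close> leaves an integer numerator, which the prime argument
  exploits.\<close>

definition binom_mass :: "nat \<Rightarrow> nat \<Rightarrow> nat \<Rightarrow> real" where
  "binom_mass k l j =
     real ((k + l) choose j) * real k ^ j * real l ^ (k + l - j) / real (k + l) ^ (k + l)"

lemma sum_atMost_add_split: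
  fixes f :: "nat \<Rightarrow> real"
  shows "(\<Sum>j\<le>k + l. f j) = (\<Sum>j<k. f j) + (\<Sum>j=k..k + l. f j)"
proof -
  have "{..k + l} = {..<k} \<union> {k..k + l}" by auto
  then show ?thesis by (simp add: sum.union_disjoint ivl_disj_int)
qed

lemma binom_mass_nonneg: "0 \<le> binom_mass k l j"
  by (simp add: binom_mass_def)

lemma binom_mass_eq_0: "k + l < j \<Longrightarrow> binom_mass k l j = 0"
  by (simp add: binom_mass_def)

lemma binom_mass_flip:
  assumes "j \<le> k + l"
  shows "binom_mass l k (k + l - j) = binom_mass k l j"
  using assms binomial_symmetric[of j "k + l"]
  by (simp add: binom_mass_def add.commute mult_ac)

text \<open>The ratio of neighbouring masses, cleared of denominators so that it also covers
  \<open>j \<ge> k + l\<close>, where both sides vanish. The Poisson limit, the median bound and the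
  central estimate all rest on it.\<close>

lemma binom_mass_Suc:
  "binom_mass k l (Suc j) * real (Suc j) * real l
     = binom_mass k l j * (real (k + l) - real j) * real k"
proof (cases "j < k + l")
  case True
  have "Suc j * ((k + l) choose Suc j) = (k + l - j) * ((k + l) choose j)"
    by (metis binomial_absorb_comp binomial_absorption)
  then have c: "real (Suc j) * real ((k + l) choose Suc j)
      = (real (k + l) - real j) * real ((k + l) choose j)"
    using True by (metis less_imp_le_nat of_nat_diff of_nat_mult)
  have e: "k + l - j = Suc (k + l - Suc j)" using True by simp
  have "binom_mass k l (Suc j) * real (Suc j) * real l
     = (real (Suc j) * real ((k + l) choose Suc j)) * real k * real k ^ j
        * real l ^ (k + l - j) / real (k + l) ^ (k + l)"
    unfolding binom_mass_def e by (simp add: mult_ac)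
  then show ?thesis unfolding c binom_mass_def by (simp add: mult_ac)
next
  case False
  then have "binom_mass k l (Suc j) = 0" "j = k + l \<or> binom_mass k l j = 0"
    by (auto intro: binom_mass_eq_0)
  then show ?thesis by auto
qed

lemma sum_binom_mass:
  assumes "k + l > 0"
  shows "(\<Sum>j\<le>k + l. binom_mass k l j) = 1"
proof -
  have "(\<Sum>j\<le>k + l. binom_mass k l j) = (real k + real l) ^ (k + l) / real (k + l) ^ (k + l)"
    unfolding binomial_ring binom_mass_def sum_divide_distrib by simp
  then show ?thesis using assms by simp
qed

text \<open>Absorption turns \<open>j * (n choose j)\<close> into
  \<open>n * (n - 1 choose j - 1)\<close>, so the first moment reduces to the binomial theorem with
  exponent \<open>n - 1\<close>.\<close>

lemma binom_mass_mean:
  assumes "k + l > 0"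
  shows "(\<Sum>j\<le>k + l. (real j - real k) * binom_mass k l j) = 0"
proof -
  define n where "n = k + l"
  obtain m where m: "n = Suc m" using assms n_def gr0_conv_Suc by blast
  have t: "real (Suc j) * (real (Suc m choose Suc j) * real k ^ Suc j * real l ^ (Suc m - Suc j))
      = real k * real (Suc m) * (real (m choose j) * real k ^ j * real l ^ (m - j))" for j
  proof -
    have "real (Suc j) * real (Suc m choose Suc j) = real (Suc m) * real (m choose j)"
      using binomial_absorption[of j "Suc m"] by (metis diff_Suc_1 of_nat_mult)
    then show ?thesis by (simp add: mult_ac del: of_nat_Suc binomial_Suc_Suc)
  qed
  have "(\<Sum>j\<le>n. real j * (real (n choose j) * real k ^ j * real l ^ (n - j)))
      = real k * real n * real n ^ m"
    unfolding m sum.atMost_Suc_shift t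
    by (simp flip: sum_distrib_left binomial_ring)
       (use n_def m in \<open>metis of_nat_Suc of_nat_add\<close>)
  then have "(\<Sum>j\<le>n. real j * binom_mass k l j) = real k"
    using assms unfolding binom_mass_def n_def[symmetric] times_divide_eq_right
    by (simp add: m n_def flip: sum_divide_distrib)
  then show ?thesis
    using sum_binom_mass[OF assms]
    by (simp add: left_diff_distrib sum_subtractf n_def flip: sum_distrib_left)
qed

section \<open>The incomplete beta integral as a binomial distribution function\<close>

text \<open>The derivative telescopes: by absorption, the positive part of the derivative of each
  term cancels what the earlier terms left over, and only the negative part of the last one
  survives.\<close>

lemma binomial_cdf_has_derivative:
  fixes t :: real
  assumes "m < n"
  shows "((\<lambda>t. \<Sum>j\<le>m. real (n choose j) * t ^ j * (1 - t) ^ (n - j)) has_real_derivative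
     - (real (n - m) * real (n choose m) * t ^ m * (1 - t) ^ (n - Suc m))) (at t)"
  using assms
proof (induction m)
  case 0
  show ?case by (auto intro!: derivative_eq_intros)
next
  case (Suc m)
  have "Suc m * (n choose Suc m) = (n - m) * (n choose m)"
    by (metis binomial_absorb_comp binomial_absorption)
  then have c: "real (n - m) * real (n choose m) = real (Suc m) * real (n choose Suc m)"
    by (metis of_nat_mult)
  show ?case
    unfolding sum.atMost_Suc
    apply (rule DERIV_cong)
     apply (rule DERIV_add[OF Suc.IH])
    using Suc.prems apply simp
     apply (auto intro!: derivative_eq_intros)[1]
    unfolding c using Suc.prems
    by (cases m) (simp_all add: algebra_simps)
qed

lemma P_eq_sum_binom_mass:
  assumes "k \<ge> 1" "l \<ge> 1"
  shows "P k l = (\<Sum>j<k. binom_mass k l j)"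
proof -
  obtain m where m: "k = Suc m" using assms by (metis One_nat_def Suc_le_D)
  define n where "n = k + l"
  define x where "x = real k / real n"
  define T where "T = (\<lambda>t::real. \<Sum>j\<le>m. real (n choose j) * t ^ j * (1 - t) ^ (n - j))"
  define c where "c = real (n - m) * real (n choose m)"
  have x: "x \<le> 1" using assms by (simp add: x_def n_def)
  have mn: "m < n" and nm: "n - Suc m = l" using assms by (auto simp: m n_def)
  have "(T has_real_derivative - (c * t ^ m * (1 - t) ^ l)) (at t)" for t
    using binomial_cdf_has_derivative[OF mn] unfolding T_def c_def nm .
  then have "((\<lambda>t. - (c * t ^ m * (1 - t) ^ l)) has_integral T 1 - T x) {x..1}"
    using x by (intro fundamental_theorem_of_calculus)
      (auto simp: has_real_derivative_iff_has_vector_derivative[symmetric]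
            intro: has_field_derivative_at_within)
  \<comment> \<open>Each exponent \<open>n - j\<close> is positive because
    \<open>j \<le> m < n\<close>, so \<open>1 - t\<close> occurs in every term.\<close>
  moreover have "T 1 = 0" unfolding T_def using mn by (intro sum.neutral) auto
  ultimately have "((\<lambda>t. c * t ^ m * (1 - t) ^ l) has_integral T x) {x..1}"
    using has_integral_neg[of "\<lambda>t. - (c * t ^ m * (1 - t) ^ l)" "- T x" "{x..1}"] by simp
  then have I: "c * integral {x..1} (\<lambda>t. t ^ m * (1 - t) ^ l) = T x"
    by (simp add: mult.assoc integral_unique flip: integral_mult_right)
  have "real (n choose m) = fact n / (fact m * fact (n - m))"
    using mn by (simp add: binomial_fact)
  moreover have "n - m = Suc l" using nm mn by simp
  ultimately have c: "c = fact n / (fact m * fact l)"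
    unfolding c_def by (simp add: divide_simps mult_ac)
  have x1: "1 - x = real l / real n" using assms by (simp add: x_def n_def field_simps)
  have "real (n choose j) * x ^ j * (1 - x) ^ (n - j) = binom_mass k l j" if "j \<le> m" for j
  proof -
    have "real n ^ j * real n ^ (n - j) = real n ^ n"
      using that mn by (simp flip: power_add)
    then show ?thesis
      unfolding x1 unfolding binom_mass_def n_def[symmetric] x_def power_divide by simp
  qed
  then have "T x = (\<Sum>j<k. binom_mass k l j)"
    unfolding T_def m lessThan_Suc_atMost by simp
  then show ?thesis
    using I unfolding c P_def x_def n_def m by simp
qed

text \<open>Exchanging successes and failures reflects \<open>j\<close> to \<open>k + l - j\<close>.
  The resulting sum has \<open>l + 1\<close> terms whatever \<open>k\<close> is, so its limit along
  a column can be taken termwise.\<close>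

lemma P_swap:
  assumes "k \<ge> 1" "l \<ge> 1"
  shows "P k l = 1 - (\<Sum>j\<le>l. binom_mass l k j)"
proof -
  have "(\<Sum>j\<le>l. binom_mass l k j) = (\<Sum>j=k..k + l. binom_mass k l j)"
    by (rule sum.reindex_bij_witness[of _ "\<lambda>j. k + l - j" "\<lambda>j. k + l - j"])
       (auto simp: binom_mass_flip[of _ l k, symmetric] add.commute)
  then show ?thesis
    using sum_binom_mass[of k l] assms by (simp add: P_eq_sum_binom_mass sum_atMost_add_split)
qed

lemma P_add_P_swap:
  assumes "k \<ge> 1" "l \<ge> 1"
  shows "P k l + P l k + binom_mass k l k = 1"
proof -
  have "(\<Sum>j\<le>l. binom_mass l k j) = P l k + binom_mass l k l"
    using assms by (simp add: P_eq_sum_binom_mass flip: lessThan_Suc_atMost)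
  then show ?thesis
    using P_swap[OF assms] binom_mass_flip[of k k l] by simp
qed

section \<open>Poisson limits\<close>

text \<open>The mass at 0 is \<open>(1 - k / (k + l)) ^ (k + l)\<close>, and the ratio of the masses
  at \<open>j + 1\<close> and \<open>j\<close> tends to \<open>k / (j + 1)\<close>.\<close>

lemma binom_mass_tendsto:
  "(\<lambda>l. binom_mass k l j) \<longlonglongrightarrow> exp (- real k) * (real k ^ j / fact j)"
proof (induction j)
  case 0
  have "(\<lambda>l. (1 + (- real k) / real (l + k)) ^ (l + k)) \<longlonglongrightarrow> exp (- real k)"
    by (rule LIMSEQ_ignore_initial_segment[OF tendsto_exp_limit_sequentially])
  moreover have "\<forall>\<^sub>F l in sequentially.
      (1 + (- real k) / real (l + k)) ^ (l + k) = binom_mass k l 0"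
    using eventually_gt_at_top[of 0]
  proof eventually_elim
    case (elim l)
    then have "1 + (- real k) / real (l + k) = real l / real (k + l)"
      by (simp add: field_simps)
    then show ?case
      unfolding binom_mass_def by (simp add: power_divide add.commute)
  qed
  ultimately show ?case
    by (simp add: tendsto_cong)
next
  case (Suc j)
  have "(\<lambda>l. 1 + (real k - real j) / real l) \<longlonglongrightarrow> 1 + 0"
    by (intro tendsto_add tendsto_const lim_const_over_n)
  then have "(\<lambda>l. binom_mass k l j * (1 + (real k - real j) / real l) * (real k / real (Suc j)))
     \<longlonglongrightarrow> exp (- real k) * (real k ^ j / fact j) * (1 + 0) * (real k / real (Suc j))"
    by (intro tendsto_intros Suc.IH)
  moreover have "\<forall>\<^sub>F l in sequentially.
     binom_mass k l j * (1 + (real k - real j) / real l) * (real k / real (Suc j))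
       = binom_mass k l (Suc j)"
    using eventually_gt_at_top[of 0]
  proof eventually_elim
    case (elim l)
    have "binom_mass k l j * (1 + (real k - real j) / real l) * (real k / real (Suc j))
        = binom_mass k l j * (real (k + l) - real j) * real k / (real (Suc j) * real l)"
      using elim by (simp add: field_simps)
    also have "\<dots> = binom_mass k l (Suc j)"
      unfolding binom_mass_Suc[symmetric] using elim by simp
    finally show ?case .
  qed
  ultimately show ?case
    by (simp add: tendsto_cong mult_ac)
qed

lemma P_tendsto_row:
  assumes "k \<ge> 1"
  shows "(\<lambda>m. P k (Suc m)) \<longlonglongrightarrow> exp (- real k) * (\<Sum>j = 0..k - 1. real k ^ j / fact j)"
proof -
  have "(\<lambda>l. \<Sum>j<k. binom_mass k l j) \<longlonglongrightarrow> (\<Sum>j<k. exp (- real k) * (real k ^ j / fact j))"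
    by (intro tendsto_sum binom_mass_tendsto)
  then have "(\<lambda>m. \<Sum>j<k. binom_mass k (Suc m) j) \<longlonglongrightarrow> (\<Sum>j<k. exp (- real k) * (real k ^ j / fact j))"
    by (rule LIMSEQ_Suc)
  moreover have "{0..k - 1} = {..<k}" using assms by auto
  ultimately show ?thesis
    using assms by (simp add: P_eq_sum_binom_mass sum_distrib_left)
qed

lemma P_tendsto_column:
  assumes "l \<ge> 1"
  shows "(\<lambda>m. P (Suc m) l) \<longlonglongrightarrow> 1 - exp (- real l) * (\<Sum>j = 0..l. real l ^ j / fact j)"
proof -
  have "(\<lambda>k. 1 - (\<Sum>j\<le>l. binom_mass l k j))
      \<longlonglongrightarrow> 1 - (\<Sum>j\<le>l. exp (- real l) * (real l ^ j / fact j))"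
    by (intro tendsto_intros binom_mass_tendsto)
  then have "(\<lambda>m. 1 - (\<Sum>j\<le>l. binom_mass l (Suc m) j))
      \<longlonglongrightarrow> 1 - (\<Sum>j\<le>l. exp (- real l) * (real l ^ j / fact j))"
    by (rule LIMSEQ_Suc)
  then show ?thesis
    using assms by (simp add: P_swap sum_distrib_left atLeast0AtMost)
qed

section \<open>Balanced parameters\<close>

text \<open>The median bound. Compare the masses \<open>A i\<close> at \<open>k - 1 - i\<close> and \<open>B i\<close> at \<open>k + i\<close>. For \<open>k \<le> l\<close>,
  \<open>A \<le> B\<close> pointwise. For \<open>k > l\<close>, the quotient \<open>B i / A i\<close> starts above 1 and falls below 1 at most
  once, at \<open>c\<close> say, so \<open>(i - c) * (B i - A i) \<le> 0\<close> for all \<open>i\<close>; summing this and using that the mean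
  is \<open>k\<close> gives \<open>sum A \<le> c * (sum B - sum A)\<close>.\<close>

lemma sum_binom_mass_le:
  assumes "k \<ge> 1" "l \<ge> 1"
  shows "(\<Sum>j<k. binom_mass k l j) \<le> (\<Sum>j=k..k + l. binom_mass k l j)"
proof -
  define A where "A = (\<lambda>i. binom_mass k l (k - Suc i))"
  define B where "B = (\<lambda>i. binom_mass k l (k + i))"
  define K L where "K = real k" and "L = real l"
  have K: "K > 0" and L: "L > 0" using assms by (auto simp: K_def L_def)
  have nonneg: "A i \<ge> 0" "B i \<ge> 0" for i
    by (simp_all add: A_def B_def binom_mass_nonneg)
  have B0: "B i = 0" if "i > l" for i
    using that by (simp add: B_def binom_mass_eq_0)
  have A_Suc: "A (Suc i) * ((L + i + 2) * K) = A i * ((K - 1 - i) * L)" if "Suc i < k" for i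
  proof -
    have "Suc (k - Suc (Suc i)) = k - Suc i" using that by simp
    with binom_mass_Suc[of k l "k - Suc (Suc i)"] that show ?thesis
      by (simp add: A_def K_def L_def of_nat_diff algebra_simps)
  qed
  have B_Suc: "B (Suc i) * ((K + i + 1) * L) = B i * ((L - i) * K)" for i
    using binom_mass_Suc[of k l "k + i"]
    by (simp add: B_def K_def L_def algebra_simps)
  \<comment> \<open>\<open>up i\<close> says that \<open>B i / A i\<close> does not decrease from
    \<open>i\<close> to \<open>i + 1\<close>, cross-multiplied from \<open>A_Suc\<close> and
    \<open>B_Suc\<close>.\<close>
  define up where "up = (\<lambda>i::nat. (K - 1 - i) * (K + i + 1) * L\<^sup>2 \<le> (L - i) * (L + i + 2) * K\<^sup>2)"
  \<comment> \<open>The products are \<open>K^2 - (i + 1)^2\<close> and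
    \<open>(L + 1)^2 - (i + 1)^2\<close>. Hence the sign of \<open>K^2 - L^2\<close> decides whether
    \<open>up\<close> always holds or can only switch from true to false.\<close>
  have up_iff: "up i \<longleftrightarrow> (real i + 1)\<^sup>2 * (K\<^sup>2 - L\<^sup>2) \<le> (2 * L + 1) * K\<^sup>2" for i
    unfolding up_def by (simp add: algebra_simps power2_eq_square)
  have step: "A i \<le> B i \<Longrightarrow> up i \<Longrightarrow> A (Suc i) \<le> B (Suc i)"
    "B i \<le> A i \<Longrightarrow> \<not> up i \<Longrightarrow> B (Suc i) \<le> A (Suc i)" if i: "Suc i < k" for i
  proof -
    define X Y D where "X = (K - 1 - i) * (K + i + 1) * L\<^sup>2"
      and "Y = (L - i) * (L + i + 2) * K\<^sup>2"
      and "D = (K + i + 1) * L * ((L + i + 2) * K)"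
    have D: "D > 0" using K L by (simp add: D_def)
    have "B (Suc i) * D = B (Suc i) * ((K + i + 1) * L) * ((L + i + 2) * K)"
      by (simp add: D_def mult_ac)
    also have "\<dots> = B i * Y" unfolding B_Suc by (simp add: Y_def power2_eq_square mult_ac)
    finally have B: "B (Suc i) * D = B i * Y" .
    have "A (Suc i) * D = A (Suc i) * ((L + i + 2) * K) * ((K + i + 1) * L)"
      by (simp add: D_def mult_ac)
    also have "\<dots> = A i * X" unfolding A_Suc[OF i] by (simp add: X_def power2_eq_square mult_ac)
    finally have A: "A (Suc i) * D = A i * X" .
    \<comment> \<open>\<open>Y\<close> is negative for \<open>i > l\<close>, so the monotonicity
      arguments below use only the signs of \<open>X\<close>, \<open>A i\<close> and
      \<open>B i\<close>.\<close>
    have X: "X \<ge> 0" using i by (simp add: X_def K_def)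
    show "A (Suc i) \<le> B (Suc i)" if "A i \<le> B i" "up i"
    proof -
      have "X \<le> Y" using that by (simp add: up_def X_def Y_def)
      then have "A i * X \<le> B i * Y" using that X nonneg by (intro mult_mono) auto
      then show ?thesis using D by (simp flip: A B)
    qed
    show "B (Suc i) \<le> A (Suc i)" if "B i \<le> A i" "\<not> up i"
    proof -
      have "Y \<le> X" using that by (simp add: up_def X_def Y_def)
      then have "B i * Y \<le> B i * X" using nonneg by (intro mult_left_mono) auto
      also have "\<dots> \<le> A i * X" using that X by (intro mult_right_mono) auto
      finally show ?thesis using D by (simp flip: A B)
    qed
  qed
  have base: "A 0 \<le> B 0"
  proof -
    have "(B 0 * L) * K = (A 0 * (L + 1)) * K"
      using binom_mass_Suc[of k l "k - 1"] assms
      by (simp add: A_def B_def K_def L_def of_nat_diff algebra_simps)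
    then have "B 0 * L = A 0 * (L + 1)" using K by simp
    then have "A 0 * L \<le> B 0 * L" using nonneg(1)[of 0] by (simp add: distrib_left)
    then show ?thesis using L by simp
  qed
  have sumA: "(\<Sum>j<k. binom_mass k l j) = (\<Sum>i<k. A i)"
    unfolding A_def by (rule sum.nat_diff_reindex[symmetric])
  have sumB: "(\<Sum>j=k..k + l. binom_mass k l j) = (\<Sum>i\<le>l. B i)"
    unfolding B_def by (rule sum.reindex_bij_witness[of _ "\<lambda>j. k + j" "\<lambda>j. j - k"]) auto
  show ?thesis
  proof (cases "k \<le> l")
    case True
    have "K\<^sup>2 - L\<^sup>2 \<le> 0" using True by (simp add: K_def L_def power_mono)
    then have "(real i + 1)\<^sup>2 * (K\<^sup>2 - L\<^sup>2) \<le> 0" for i by (simp add: mult_nonneg_nonpos)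
    moreover have "0 \<le> (2 * L + 1) * K\<^sup>2" using L by simp
    ultimately have up: "up i" for i by (subst up_iff) (rule order_trans)
    have "i < k \<Longrightarrow> A i \<le> B i" for i
      by (induction i) (use base step(1) up in auto)
    then have "(\<Sum>i<k. A i) \<le> (\<Sum>i<k. B i)" by (intro sum_mono) simp
    also have "\<dots> \<le> (\<Sum>i\<le>l. B i)" using True nonneg by (intro sum_mono2) auto
    finally show ?thesis using sumA sumB by simp
  next
    case False
    have "K\<^sup>2 - L\<^sup>2 \<ge> 0" using False by (simp add: K_def L_def power_mono)
    then have "(real i + 1)\<^sup>2 * (K\<^sup>2 - L\<^sup>2) \<le> (real j + 1)\<^sup>2 * (K\<^sup>2 - L\<^sup>2)" if "i \<le> j" for i j :: nat
      using that by (intro mult_right_mono power_mono) auto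
    then have up_anti: "up i" if "up j" "i \<le> j" for i j
      using that by (meson up_iff order_trans)
    have sumB': "(\<Sum>i\<le>l. B i) = (\<Sum>i<k. B i)"
      using False B0 by (intro sum.mono_neutral_left) auto
    show ?thesis
    proof (cases "\<exists>i<k. B i < A i")
      case False
      then have "(\<Sum>i<k. A i) \<le> (\<Sum>i<k. B i)" by (intro sum_mono) (metis lessThan_iff not_less)
      then show ?thesis using sumA sumB sumB' by simp
    next
      case True
      then obtain c where c: "c < k" "B c < A c" and "\<forall>i<c. \<not> (i < k \<and> B i < A i)"
        using exists_least_iff[of "\<lambda>i. i < k \<and> B i < A i"] by blast
      then have c_least: "A i \<le> B i" if "i < c" for i using that by fastforce
      have "c \<noteq> 0" using base c(2) by (metis not_le)
      then obtain d where d: "c = Suc d" by (metis not0_implies_Suc)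
      \<comment> \<open>The order of \<open>A\<close> and \<open>B\<close> first reverses between
        \<open>d\<close> and \<open>c\<close>, so the quotient drops there; by
        \<open>up_anti\<close> it keeps dropping, and no second reversal occurs.\<close>
      have "\<not> up d" using step(1)[of d] c c_least[of d] d by (auto simp: not_le)
      then have not_up: "\<not> up i" if "i \<ge> c" for i
        using up_anti[of i d] that d \<open>\<not> up d\<close> by auto
      have after: "B i \<le> A i" if "c \<le> i" "i < k" for i
        using that by (induction i rule: dec_induct) (use c step(2) not_up in auto)
      \<comment> \<open>The mean identity split at \<open>k\<close>: \<open>A i\<close> sits at
        distance \<open>i + 1\<close> below the mean, \<open>B i\<close> at distance
        \<open>i\<close> above it.\<close>
      have mean: "(\<Sum>i<k. real i * B i) = (\<Sum>i<k. (real i + 1) * A i)"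
      proof -
        let ?f = "\<lambda>j. (real j - real k) * binom_mass k l j"
        have "(\<Sum>j<k. ?f j) = (\<Sum>i<k. ?f (k - Suc i))"
          by (rule sum.nat_diff_reindex[symmetric])
        also have "\<dots> = (\<Sum>i<k. - ((real i + 1) * A i))"
          by (intro sum.cong) (auto simp: A_def of_nat_diff algebra_simps)
        finally have low: "(\<Sum>j<k. ?f j) = - (\<Sum>i<k. (real i + 1) * A i)"
          by (simp add: sum_negf)
        have "(\<Sum>j=k..k + l. ?f j) = (\<Sum>i\<le>l. real i * B i)"
          unfolding B_def by (rule sum.reindex_bij_witness[of _ "\<lambda>j. k + j" "\<lambda>j. j - k"]) auto
        also have "\<dots> = (\<Sum>i<k. real i * B i)"
          using False B0 by (intro sum.mono_neutral_left) auto
        finally have high: "(\<Sum>j=k..k + l. ?f j) = (\<Sum>i<k. real i * B i)" .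
        show ?thesis
          using low high binom_mass_mean[of k l] assms sum_atMost_add_split[of ?f k l] by simp
      qed
      have "(\<Sum>i<k. (real i - real c) * (B i - A i)) \<le> 0"
      proof (intro sum_nonpos)
        fix i assume "i \<in> {..<k}"
        then show "(real i - real c) * (B i - A i) \<le> 0"
          using c_least[of i] after[of i] by (cases "i < c") (auto simp: mult_le_0_iff)
      qed
      moreover have "(\<Sum>i<k. (real i - real c) * (B i - A i))
        = (\<Sum>i<k. real i * B i) - (\<Sum>i<k. (real i + 1) * A i) + (\<Sum>i<k. A i)
          - real c * ((\<Sum>i<k. B i) - (\<Sum>i<k. A i))"
        by (simp add: algebra_simps sum.distrib sum_subtractf sum_distrib_left)
      moreover have "0 \<le> (\<Sum>i<k. A i)" using nonneg by (simp add: sum_nonneg)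
      ultimately have "0 \<le> real c * ((\<Sum>i<k. B i) - (\<Sum>i<k. A i))" using mean by linarith
      then show ?thesis using d sumA sumB sumB' by (simp add: zero_le_mult_iff)
    qed
  qed
qed

lemma P_le_half:
  assumes "k \<ge> 1" "l \<ge> 1"
  shows "P k l \<le> 1 / 2"
  using sum_binom_mass[of k l] sum_binom_mass_le[OF assms] assms
  by (simp add: P_eq_sum_binom_mass sum_atMost_add_split)

section \<open>Decay of the central mass\<close>

text \<open>The step from \<open>k + i\<close> to \<open>k + i + 1\<close> loses at most the
  fraction \<open>(2 * i + 1) / m\<close> of the current mass, hence at most that fraction of the
  central one. The losses add up, and the first \<open>i\<close> odd numbers sum to
  \<open>i^2\<close>.\<close>

lemma binom_mass_near_center:
  assumes "m \<ge> 1" "k \<ge> m" "l \<ge> m" "i \<le> m"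
  shows "binom_mass k l k * (1 - (real i)\<^sup>2 / real m) \<le> binom_mass k l (k + i)
    \<and> binom_mass k l (k + i) \<le> binom_mass k l k"
  using assms(4)
proof (induction i)
  case (Suc i)
  define c b where "c = binom_mass k l k" and "b = binom_mass k l (k + i)"
  define \<rho> where "\<rho> = (real l - i) * real k / ((real k + i + 1) * real l)"
  have pos: "real k > 0" "real l > 0" "real m > 0" using assms by auto
  have IH: "c * (1 - (real i)\<^sup>2 / real m) \<le> b" "b \<le> c" "0 \<le> b"
    using Suc by (auto simp: c_def b_def binom_mass_nonneg)
  have "b * \<rho> = b * (real (k + l) - real (k + i)) * real k / (real (Suc (k + i)) * real l)"
    by (simp add: \<rho>_def algebra_simps)
  also have "\<dots> = binom_mass k l (k + Suc i)"
    unfolding b_def binom_mass_Suc[symmetric] using pos by simp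
  finally have next_b: "binom_mass k l (k + Suc i) = b * \<rho>" ..
  have "\<rho> \<le> 1"
    using pos by (simp add: \<rho>_def divide_simps) (simp add: algebra_simps)
  have "1 - (2 * real i + 1) / real m \<le> 1 - real i / real l - (real i + 1) / real k"
  proof -
    have "real i / real l \<le> real i / real m" "(real i + 1) / real k \<le> (real i + 1) / real m"
      using assms pos by (auto intro!: divide_left_mono)
    then show ?thesis by (simp add: add_divide_distrib)
  qed
  also have "\<dots> \<le> \<rho>"
  proof -
    have "\<rho> = (1 - real i / real l) * (real k / (real k + i + 1))"
      using pos by (simp add: \<rho>_def field_simps)
    moreover have "1 - (real i + 1) / real k \<le> real k / (real k + i + 1)"
      using pos by (simp add: field_simps)
    moreover have "0 \<le> 1 - real i / real l"
      using Suc.prems assms pos by (simp add: field_simps)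
    ultimately have "(1 - real i / real l) * (1 - (real i + 1) / real k) \<le> \<rho>"
      by (metis mult_left_mono)
    moreover have "0 \<le> real i / real l * ((real i + 1) / real k)" by simp
    moreover have "(1 - x) * (1 - y) = 1 - x - y + x * y" for x y :: real
      by (simp add: algebra_simps)
    ultimately show ?thesis by (metis add_increasing2 order_refl order_trans)
  qed
  finally have "b * (1 - (2 * real i + 1) / real m) \<le> b * \<rho>"
    using IH by (intro mult_left_mono)
  moreover have "b * ((2 * real i + 1) / real m) \<le> c * ((2 * real i + 1) / real m)"
    using IH by (intro mult_right_mono) auto
  moreover have "c * (1 - (real (Suc i))\<^sup>2 / real m)
      = c * (1 - (real i)\<^sup>2 / real m) - c * ((2 * real i + 1) / real m)"
    using pos by (simp add: field_simps power2_eq_square)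
  ultimately have "c * (1 - (real (Suc i))\<^sup>2 / real m) \<le> b * \<rho>"
    using IH by (simp add: algebra_simps)
  moreover have "b * \<rho> \<le> c"
    using IH mult_left_mono[OF \<open>\<rho> \<le> 1\<close> IH(3)] by simp
  ultimately show ?case by (simp only: next_b c_def[symmetric])
qed simp

text \<open>With \<open>m = 2 * N^2\<close>, each of the \<open>N\<close> masses from
  \<open>k\<close> upwards is at least half the central one, and together they are at most
  1.\<close>

lemma binom_mass_center_le:
  assumes "N \<ge> 1" "k \<ge> 2 * N\<^sup>2" "l \<ge> 2 * N\<^sup>2"
  shows "binom_mass k l k \<le> 2 / real N"
proof -
  define m c where "m = 2 * N\<^sup>2" and "c = binom_mass k l k"
  have c: "c \<ge> 0" by (simp add: c_def binom_mass_nonneg)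
  have "N \<le> N\<^sup>2" using assms(1) by (simp add: power2_eq_square)
  then have N: "N \<le> m" "m \<ge> 1" using assms(1) unfolding m_def by linarith+
  have "c / 2 \<le> binom_mass k l (k + i)" if "i < N" for i
  proof -
    have "(real i)\<^sup>2 \<le> (real N)\<^sup>2" using that by (simp add: power_mono)
    then have "(real i)\<^sup>2 / real m \<le> 1 / 2" using assms(1) by (simp add: m_def divide_simps)
    then have "c * (1 / 2) \<le> c * (1 - (real i)\<^sup>2 / real m)" using c by (intro mult_left_mono) auto
    then show ?thesis
      using binom_mass_near_center[of m k l i] that N assms by (simp add: c_def m_def)
  qed
  then have "(\<Sum>i<N. c / 2) \<le> (\<Sum>i<N. binom_mass k l (k + i))" by (intro sum_mono) simp
  also have "\<dots> = (\<Sum>j\<in>(\<lambda>i. k + i) ` {..<N}. binom_mass k l j)"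
    by (simp add: sum.reindex)
  also have "\<dots> \<le> (\<Sum>j\<le>k + l. binom_mass k l j)"
    using N assms by (intro sum_mono2) (auto simp: binom_mass_nonneg m_def)
  also have "\<dots> = 1" using N assms by (intro sum_binom_mass) (simp add: m_def)
  finally show ?thesis using assms(1) by (simp add: c_def field_simps)
qed

lemma P_near_half:
  assumes "e > 0"
  shows "\<exists>M\<ge>1. \<forall>k\<ge>M. \<forall>l\<ge>M. \<bar>P k l - 1 / 2\<bar> \<le> e"
proof -
  obtain N where N: "real N > 2 / e" using reals_Archimedean2 by blast
  have "N \<ge> 1" using N assms by (cases N) auto
  have "2 / real N \<le> e" using N assms \<open>N \<ge> 1\<close> by (simp add: field_simps)
  have "\<bar>P k l - 1 / 2\<bar> \<le> e" if "k \<ge> 2 * N\<^sup>2" "l \<ge> 2 * N\<^sup>2" for k l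
  proof -
    have "2 * N\<^sup>2 \<ge> 1" using \<open>N \<ge> 1\<close> by simp
    then have "k \<ge> 1" "l \<ge> 1" using that by linarith+
    then show ?thesis
      using P_le_half[of k l] P_le_half[of l k] P_add_P_swap[of k l]
        binom_mass_center_le[OF \<open>N \<ge> 1\<close> that] \<open>2 / real N \<le> e\<close> by linarith
  qed
  moreover have "2 * N\<^sup>2 \<ge> 1" using \<open>N \<ge> 1\<close> by simp
  ultimately show ?thesis by blast
qed

section \<open>Infinitely many values\<close>

text \<open>Modulo \<open>p\<close> only the term \<open>l ^ p\<close> of the numerator survives,
  and \<open>0 < l < p\<close>.\<close>

lemma P_prime_denominator:
  assumes "prime p" "k + l = p" "k \<ge> 1" "l \<ge> 1"
  shows "\<exists>N. \<not> p dvd N \<and> P k l = real N / real (p ^ p)"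
proof -
  define N where "N = (\<Sum>j<k. (p choose j) * k ^ j * l ^ (p - j))"
  have "P k l = real N / real (p ^ p)"
    using assms by (simp add: P_eq_sum_binom_mass binom_mass_def N_def sum_divide_distrib)
  moreover have "\<not> p dvd N"
  proof
    assume "p dvd N"
    have "{..<k} = insert 0 {1..<k}" using assms by auto
    then have "N = l ^ p + (\<Sum>j=1..<k. (p choose j) * k ^ j * l ^ (p - j))"
      by (simp add: N_def)
    moreover have "p dvd (\<Sum>j=1..<k. (p choose j) * k ^ j * l ^ (p - j))"
      using assms by (intro dvd_sum dvd_mult2 dvd_choose_prime) auto
    ultimately have "p dvd l ^ p" using \<open>p dvd N\<close> by (metis dvd_add_left_iff)
    then have "p dvd l" using \<open>prime p\<close> prime_dvd_power by blast
    then show False using assms by (auto dest: dvd_imp_le)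
  qed
  ultimately show ?thesis by blast
qed

lemma P_eq_imp_prime_eq:
  assumes "P k l = P k' l'" "prime (k + l)" "prime (k' + l')"
    and "k \<ge> 1" "l \<ge> 1" "k' \<ge> 1" "l' \<ge> 1"
  shows "k + l = k' + l'"
proof -
  define p q where "p = k + l" and "q = k' + l'"
  have pq: "prime p" "prime q" using assms by (auto simp: p_def q_def)
  obtain M N where M: "\<not> p dvd M" "P k l = real M / real (p ^ p)"
    and N: "P k' l' = real N / real (q ^ q)"
    using P_prime_denominator assms p_def q_def by metis
  have "real M * real (q ^ q) = real N * real (p ^ p)"
    using M(2) N assms(1) pq by (simp add: field_simps prime_gt_0_nat)
  then have "M * q ^ q = N * p ^ p" by (metis of_nat_eq_iff of_nat_mult)
  then have "p dvd M * q ^ q" using pq by (simp add: prime_gt_0_nat)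
  then have "p dvd q" using M(1) pq prime_dvd_mult_nat prime_dvd_power by blast
  then show ?thesis using pq primes_dvd_imp_eq by (auto simp: p_def q_def)
qed

text \<open>Convergence alone is not enough, since the sequence might be eventually constant.
  Distinct prime values of \<open>f m + g m\<close> force distinct values of \<open>P\<close>, so
  every neighbourhood of the limit contains infinitely many of them.\<close>

lemma islimpt_P:
  assumes lim: "(\<lambda>m. P (f m) (g m)) \<longlonglongrightarrow> a"
    and ge1: "\<And>m. f m \<ge> 1" "\<And>m. g m \<ge> 1"
    and inj: "inj (\<lambda>m. f m + g m)"
    and primes: "infinite {m. prime (f m + g m)}"
  shows "a islimpt {P k l | k l. k \<ge> 1 \<and> l \<ge> 1}"
  unfolding islimpt_eq_acc_point
proof (intro allI impI)
  fix U assume "a \<in> U" "open U"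
  then obtain n where n: "\<And>m. m \<ge> n \<Longrightarrow> P (f m) (g m) \<in> U"
    using lim by (metis lim_explicit)
  let ?M = "{m. prime (f m + g m)} - {..<n}"
  have "infinite ?M" using primes by simp
  moreover have "inj_on (\<lambda>m. P (f m) (g m)) ?M"
    using P_eq_imp_prime_eq ge1 injD[OF inj] by (intro inj_onI) blast
  ultimately have "infinite ((\<lambda>m. P (f m) (g m)) ` ?M)" by (simp add: finite_image_iff)
  moreover have "(\<lambda>m. P (f m) (g m)) ` ?M \<subseteq> U \<inter> {P k l | k l. k \<ge> 1 \<and> l \<ge> 1}"
  proof
    fix x assume "x \<in> (\<lambda>m. P (f m) (g m)) ` ?M"
    then obtain m where m: "x = P (f m) (g m)" "m \<in> ?M" by blast
    from m(2) have "m \<ge> n" by simp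
    with n m(1) have "x \<in> U" by simp
    have "x \<in> {P k l | k l. k \<ge> 1 \<and> l \<ge> 1}" using m(1) ge1 by blast
    with \<open>x \<in> U\<close> show "x \<in> U \<inter> {P k l | k l. k \<ge> 1 \<and> l \<ge> 1}" ..
  qed
  ultimately show "infinite (U \<inter> {P k l | k l. k \<ge> 1 \<and> l \<ge> 1})"
    using finite_subset by blast
qed

lemma infinite_prime_preimage:
  fixes h :: "nat \<Rightarrow> nat"
  assumes "\<And>p. prime p \<Longrightarrow> p > c \<Longrightarrow> p \<in> range h"
  shows "infinite {m. prime (h m)}"
proof
  assume "finite {m. prime (h m)}"
  then have "finite (h ` {m. prime (h m)} \<union> {..c})" by simp
  moreover have "{p. prime p} \<subseteq> h ` {m. prime (h m)} \<union> {..c}"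
    using assms by (auto simp: not_less) (metis (mono_tags) imageI mem_Collect_eq not_le rangeE)
  ultimately show False using primes_infinite finite_subset by blast
qed

lemma P_islimpt_half: "1 / 2 islimpt {P k l | k l. k \<ge> 1 \<and> l \<ge> 1}"
\<comment> \<open>The offset by one makes the sum \<open>2 * m + 3\<close>, which reaches every odd
  prime; equal parameters would give even sums only.\<close>
proof (rule islimpt_P[of "\<lambda>m. Suc m" "\<lambda>m. Suc (Suc m)"])
  show "(\<lambda>m. P (Suc m) (Suc (Suc m))) \<longlonglongrightarrow> 1 / 2"
  proof (rule LIMSEQ_I)
    fix r :: real assume "r > 0"
    then obtain M where "\<forall>k\<ge>M. \<forall>l\<ge>M. \<bar>P k l - 1 / 2\<bar> \<le> r / 2"
      using P_near_half[of "r / 2"] by auto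
    then have "\<bar>P (Suc m) (Suc (Suc m)) - 1 / 2\<bar> \<le> r / 2" if "m \<ge> M" for m using that by simp
    then show "\<exists>no. \<forall>m\<ge>no. norm (P (Suc m) (Suc (Suc m)) - 1 / 2) < r"
      using \<open>r > 0\<close> by (intro exI[of _ M]) force
  qed
  show "infinite {m. prime (Suc m + Suc (Suc m))}"
  proof (rule infinite_prime_preimage[of 2])
    fix p :: nat assume "prime p" "p > 2"
    then have "odd p" using prime_odd_nat by simp
    then have "p = Suc ((p - 3) div 2) + Suc (Suc ((p - 3) div 2))"
      using \<open>p > 2\<close> by presburger
    then show "p \<in> range (\<lambda>m. Suc m + Suc (Suc m))" by blast
  qed
qed (auto simp: inj_def)

lemma P_islimpt_row:
  assumes "k \<ge> 1"
  shows "exp (- real k) * (\<Sum>j = 0..k - 1. real k ^ j / fact j)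
    islimpt {P k l | k l. k \<ge> 1 \<and> l \<ge> 1}"
proof (rule islimpt_P[of "\<lambda>m. k" "\<lambda>m. Suc m"])
  show "infinite {m. prime (k + Suc m)}"
  proof (rule infinite_prime_preimage[of k])
    fix p :: nat assume "prime p" "p > k"
    then have "p = k + Suc (p - k - 1)" by simp
    then show "p \<in> range (\<lambda>m. k + Suc m)" by blast
  qed
qed (use assms P_tendsto_row in \<open>auto simp: inj_def\<close>)

lemma P_islimpt_column:
  assumes "l \<ge> 1"
  shows "1 - exp (- real l) * (\<Sum>j = 0..l. real l ^ j / fact j)
    islimpt {P k l | k l. k \<ge> 1 \<and> l \<ge> 1}"
proof (rule islimpt_P[of "\<lambda>m. Suc m" "\<lambda>m. l"])
  show "infinite {m. prime (Suc m + l)}"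
  proof (rule infinite_prime_preimage[of l])
    fix p :: nat assume "prime p" "p > l"
    then have "p = Suc (p - l - 1) + l" by simp
    then show "p \<in> range (\<lambda>m. Suc m + l)" by blast
  qed
qed (use assms P_tendsto_column in \<open>auto simp: inj_def\<close>)

section \<open>Excluding further accumulation points\<close>

text \<open>Once both parameters are large, \<open>P\<close> stays in a closed ball around
  \<open>1 / 2\<close> that misses \<open>a\<close>. What remains lies in finitely many rows and
  columns, and an accumulation point of a finite union is one of some member.\<close>

lemma islimpt_P_cases:
  assumes a: "a islimpt {P k l | k l. k \<ge> 1 \<and> l \<ge> 1}" and "a \<noteq> 1 / 2"
  obtains k where "k \<ge> 1" "a islimpt range (\<lambda>m. P k (Suc m))"
  | l where "l \<ge> 1" "a islimpt range (\<lambda>m. P (Suc m) l)"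
proof -
  define e where "e = \<bar>a - 1 / 2\<bar> / 2"
  have "e > 0" using assms(2) by (simp add: e_def)
  then obtain M where M: "\<And>k l. k \<ge> M \<Longrightarrow> l \<ge> M \<Longrightarrow> \<bar>P k l - 1 / 2\<bar> \<le> e"
    using P_near_half by blast
  let ?R = "\<Union>k\<in>{1..<M}. range (\<lambda>m. P k (Suc m))"
  let ?C = "\<Union>l\<in>{1..<M}. range (\<lambda>m. P (Suc m) l)"
  have "{P k l | k l. k \<ge> 1 \<and> l \<ge> 1} \<subseteq> ?R \<union> ?C \<union> cball (1 / 2) e"
  proof clarify
    fix k l :: nat
    assume kl: "1 \<le> k" "1 \<le> l" "P k l \<notin> cball (1 / 2) e" "P k l \<notin> ?C"
    obtain k' l' where s: "k = Suc k'" "l = Suc l'" using kl by (metis One_nat_def Suc_le_D)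
    have "\<not> l < M"
    proof
      assume "l < M"
      then have "P k l \<in> ?C" using kl s by (intro UN_I[of l]) auto
      then show False using kl by simp
    qed
    have "k < M"
    proof (rule ccontr)
      assume "\<not> k < M"
      then have "\<bar>P k l - 1 / 2\<bar> \<le> e" using M \<open>\<not> l < M\<close> by simp
      then show False using kl(3) by (simp add: dist_real_def abs_minus_commute)
    qed
    then show "P k l \<in> ?R" using kl s by (intro UN_I[of k]) auto
  qed
  with a have "a islimpt ?R \<union> ?C \<union> cball (1 / 2) e" by (rule islimpt_subset)
  moreover have "\<not> a islimpt cball (1 / 2) e"
  proof
    assume "a islimpt cball (1 / 2) e"
    then have "a \<in> cball (1 / 2) e" using closed_limpt closed_cball by blast
    then show False using \<open>e > 0\<close> by (simp add: e_def dist_real_def abs_minus_commute)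
  qed
  ultimately show ?thesis
    using that by (auto simp: islimpt_Un islimpt_finite_union_iff)
qed

theorem corollary1:
  shows "{a :: real. a islimpt {P k l | k l. k \<ge> 1 \<and> l \<ge> 1}} =
    {1 / 2}
    \<union> {exp (- real k) * (\<Sum>\<nu> = 0..k - 1. real k ^ \<nu> / fact \<nu>) | k :: nat. k \<ge> 1}
    \<union> {1 - exp (- real l) * (\<Sum>\<nu> = 0..l. real l ^ \<nu> / fact \<nu>) | l :: nat. l \<ge> 1}"
  (is "?L = {1 / 2} \<union> ?R \<union> ?C")
proof
  show "?L \<subseteq> {1 / 2} \<union> ?R \<union> ?C"
  proof
    fix a assume "a \<in> ?L"
    then have a: "a islimpt {P k l | k l. k \<ge> 1 \<and> l \<ge> 1}" by simp
    show "a \<in> {1 / 2} \<union> ?R \<union> ?C"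
    proof (cases "a = 1 / 2")
      case False
      from islimpt_P_cases[OF a this] show ?thesis
      proof cases
        case (1 k)
        \<comment> \<open>The range of a convergent sequence can accumulate only at its
          limit.\<close>
        from sequence_unique_limpt[OF P_tendsto_row[OF 1(1)] 1(2)] 1(1) show ?thesis by blast
      next
        case (2 l)
        from sequence_unique_limpt[OF P_tendsto_column[OF 2(1)] 2(2)] 2(1) show ?thesis by blast
      qed
    qed simp
  qed
  show "{1 / 2} \<union> ?R \<union> ?C \<subseteq> ?L"
    using P_islimpt_half P_islimpt_row P_islimpt_column by blast
qed

end
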